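(* Let $\mathcal{P}$ be a set of partitions of a finite set $Z$, and let $D=\{d_1,\dots\}$ be any collection of subsets of $\mathcal{P}$. Then $$\max_{A\in\bigcap_{d\in D}\mathcal{A}_d}\frac{\operatorname{Tr}(AJ)}{\operatorname{Tr}(A)}=\min_{B^{d_i}\in\mathcal{B}_{d_i}}\Big\|\sum_{d\in D}B^d+J\Big\|_{op}.$$ The minimum is attained with a collection of matrices $B^{d_i}\in\mathcal{B}_{d_i}$ such that $\sum_{d\in D}B^d+J$ is a multiple of the identity matrix.
   Context: $J$ is the $Z\times Z$ all-ones matrix and $\|\cdot\|_{op}$ is the operator norm. The minimum is over all choices of one matrix $B^{d}\in\mathcal{B}_{d}$ for each $d\in D$. For $d=\{p_1,\dots,p_k\}\subseteq\mathcal{P}$, define $$\mathcal{A}_d=\operatorname{Conv}\{xx^T : x\in\mathbb{R}^Z,\ \forall p_i\in d\ \exists c_i\in p_i\text{ with }x_j=0\text{ for }j\in c_i\},$$ $$\mathcal{B}_d=\{B\in\mathbb{R}^{Z\times Z}\text{ symmetric} : \forall c_1\in p_1,\dots,c_k\in p_k,\ B|_{Z\setminus(c_1\cup\cdots\cup c_k)}\succeq0\},$$ where $c\in p$ means that $c$ is a part of the partition $p$, $\operatorname{Conv}$ denotes convex hull, $B|_{Z\setminus(c_1\cup\cdots\cup c_k)}$ is the matrix formed by deleting all rows and columns in $c_1\cup\cdots\cup c_k$ from $B$, and $M\succeq0$ means that $M$ is positive semidefinite. *)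

theory Defs
  imports "HOL-Analysis.Analysis"
begin

definition all_ones :: "real ^ 'z ^ 'z" where
  "all_ones = (\<chi> i j. 1)"

definition rank_one :: "real ^ 'z \<Rightarrow> real ^ 'z ^ 'z" where
  "rank_one x = (\<chi> i j. x $ i * x $ j)"

definition A_cone :: "'z set set set \<Rightarrow> (real ^ 'z ^ 'z) set" where
  "A_cone d = convex hull {rank_one x | x. \<forall>p\<in>d. \<exists>c\<in>p. \<forall>j\<in>c. x $ j = 0}"

text \<open>Positive semidefiniteness of the principal submatrix with rows and columns in \<open>S\<close>.
  As \<open>S\<close> varies, the submatrix has no fixed matrix type, so its quadratic form is written
  out over vectors indexed by \<open>S\<close>; for \<open>S = {}\<close> it holds vacuously.\<close>

definition psd_on :: "'z set \<Rightarrow> real ^ 'z ^ 'z \<Rightarrow> bool" where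
  "psd_on S M \<longleftrightarrow> (\<forall>i\<in>S. \<forall>j\<in>S. M $ i $ j = M $ j $ i) \<and>
     (\<forall>v :: 'z \<Rightarrow> real. 0 \<le> (\<Sum>i\<in>S. \<Sum>j\<in>S. v i * M $ i $ j * v j))"

text \<open>The function \<open>c\<close> chooses one part \<open>c p\<close> of every partition \<open>p \<in> d\<close>.\<close>

definition B_cone :: "'z set set set \<Rightarrow> (real ^ 'z ^ 'z) set" where
  "B_cone d = {B. transpose B = B \<and>
     (\<forall>c. (\<forall>p\<in>d. c p \<in> p) \<longrightarrow> psd_on (UNIV - (\<Union>p\<in>d. c p)) B)}"

definition op_norm :: "real ^ 'z ^ 'z \<Rightarrow> real" where
  "op_norm M = onorm (\<lambda>x. M *v x)"

end

theory Submission
  imports Defs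
begin

text \<open>
  On symmetric matrices, the cones of type A and B attached to the same \<open>d\<close> are dual to each other,
  so the theorem is conic duality. It needs that the sum of the cones of type B is closed, so that it
  equals the dual of the intersection of the cones of type A without taking a closure.

  If some \<open>p \<in> d\<close> is the one-part partition, every symmetric matrix lies in \<open>B_cone d\<close> and
  both sides vanish. Otherwise every unit vector is admissible for every \<open>d \<in> D\<close>. Call a pair \<open>(i, j)\<close>
  allowed for \<open>d\<close> if some vector admissible for \<open>d\<close> is nonzero at both \<open>i\<close> and \<open>j\<close>. The entries of
  \<open>B \<in> B_cone d\<close> at allowed pairs are bounded by the trace of \<open>B\<close>, while the
  remaining entries are arbitrary. Hence, on a slice of bounded trace, the sum of the cones is a compact
  set plus a linear subspace, and therefore closed. With \<open>c\<close> the maximum of the left-hand side,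
  \<open>c I - J\<close> is nonnegative on the intersection of the cones of type A, hence a sum of matrices \<open>B d\<close>.
\<close>

subsection \<open>Closed cones\<close>

text \<open>A convergent sequence in \<open>S\<close> eventually satisfies
  \<open>f x < f l + 1\<close>, so one closed \<open>K\<close> inside \<open>S\<close> captures its
  tail and its limit. \<open>K\<close> may exceed the sublevel set, which lets it contain an
  unbounded linear subspace.\<close>

lemma closed_if_sublevels_closed:
  fixes S :: "'a::metric_space set" and f :: "'a \<Rightarrow> real"
  assumes cont: "continuous_on UNIV f"
    and slices: "\<And>R. \<exists>K. closed K \<and> K \<subseteq> S \<and> {x \<in> S. f x \<le> R} \<subseteq> K"
  shows "closed S"
  unfolding closed_sequential_limits
proof (intro allI impI, elim conjE)
  fix x l assume x: "\<forall>n. x n \<in> S" and lim: "x \<longlonglongrightarrow> l"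
  obtain K where K: "closed K" "K \<subseteq> S" "{x \<in> S. f x \<le> f l + 1} \<subseteq> K"
    using slices by blast
  have "(\<lambda>n. f (x n)) \<longlonglongrightarrow> f l"
    by (rule continuous_on_tendsto_compose[OF cont lim]) auto
  then have "\<forall>\<^sub>F n in sequentially. f (x n) < f l + 1"
    by (rule order_tendstoD) simp
  then have "\<forall>\<^sub>F n in sequentially. x n \<in> K"
    by eventually_elim (use x K(3) in force)
  then show "l \<in> S"
    using Lim_in_closed_set[OF K(1) _ _ lim] K(2) by auto
qed

lemma separating_hyperplane_closed_cone:
  fixes S :: "'a::euclidean_space set"
  assumes "convex S" "closed S" "cone S" "0 \<in> S" "z \<notin> S"
  obtains a where "a \<bullet> z < 0" "\<And>x. x \<in> S \<Longrightarrow> 0 \<le> a \<bullet> x"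
proof -
  obtain a b where ab: "a \<bullet> z < b" "\<forall>x\<in>S. a \<bullet> x > b"
    using separating_hyperplane_closed_point[of S z] assms by blast
  have b: "b < 0" using ab(2) \<open>0 \<in> S\<close> by force
  have "0 \<le> a \<bullet> x" if x: "x \<in> S" for x
  proof (rule ccontr)
    assume neg: "\<not> 0 \<le> a \<bullet> x"
    \<comment> \<open>This factor moves \<open>x\<close> along its ray to the level \<open>b\<close>
      exactly, which the strict separation forbids.\<close>
    then have "b / (a \<bullet> x) \<ge> 0"
      using b by (simp add: divide_nonpos_nonpos)
    then have "(b / (a \<bullet> x)) *\<^sub>R x \<in> S"
      using \<open>cone S\<close> x by (simp add: cone_def)
    then have "a \<bullet> ((b / (a \<bullet> x)) *\<^sub>R x) > b" using ab(2) by blast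
    then show False using neg by simp
  qed
  with ab(1) b that[of a] show thesis by auto
qed

lemma cone_sum:
  assumes "convex S" "cone S" "0 \<in> S" "\<And>i. i \<in> I \<Longrightarrow> f i \<in> S"
  shows "sum f I \<in> S"
  using assms(4)
proof (induction I rule: infinite_finite_induct)
  case (insert i I)
  then show ?case using assms(1,2) convex_cone[of S] by auto
qed (use assms(3) in auto)

lemma compact_setsum:
  fixes X :: "'i \<Rightarrow> 'a::real_normed_vector set"
  assumes "finite I" "\<And>i. i \<in> I \<Longrightarrow> compact (X i)"
  shows "compact {sum B I | B. \<forall>i\<in>I. B i \<in> X i}"
  using assms
proof (induction I)
  case empty
  then show ?case by simp
next
  case (insert i I)
  have "{sum B (insert i I) | B. \<forall>j\<in>insert i I. B j \<in> X j}
      = {x + y | x y. x \<in> X i \<and> y \<in> {sum B I | B. \<forall>j\<in>I. B j \<in> X j}}" (is "?l = ?r")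
  proof
    show "?l \<subseteq> ?r" using insert.hyps by auto
    show "?r \<subseteq> ?l"
    proof clarify
      fix x B assume x: "x \<in> X i" and B: "\<forall>j\<in>I. B j \<in> X j"
      have "x + sum B I = sum (B(i := x)) (insert i I)"
        using insert.hyps by (auto intro!: sum.cong)
      moreover have "\<forall>j\<in>insert i I. (B(i := x)) j \<in> X j" using x B by auto
      ultimately show "\<exists>Ba. x + sum B I = sum Ba (insert i I) \<and> (\<forall>j\<in>insert i I. Ba j \<in> X j)"
        by blast
    qed
  qed
  moreover have "compact {x + y | x y. x \<in> X i \<and> y \<in> {sum B I | B. \<forall>j\<in>I. B j \<in> X j}}"
    by (rule compact_sums) (use insert in auto)
  ultimately show ?case by metis
qed

subsection \<open>Matrices\<close>

lemma inner_matrix: "A \<bullet> B = (\<Sum>i\<in>UNIV. \<Sum>j\<in>UNIV. A $ i $ j * B $ i $ j)"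
  for A B :: "real ^ 'n ^ 'm"
  by (simp add: inner_vec_def)

lemma trace_eq_inner: "trace A = A \<bullet> mat 1" for A :: "real ^ 'n ^ 'n"
  by (simp add: inner_matrix trace_def mat_def if_distrib[of "(*) _"] cong: if_cong)

lemma trace_mult_all_ones: "trace (A ** all_ones) = A \<bullet> all_ones" for A :: "real ^ 'n ^ 'n"
  by (simp add: inner_matrix trace_def all_ones_def matrix_matrix_mult_def)

lemma inner_transpose: "transpose A \<bullet> transpose B = A \<bullet> B" for A B :: "real ^ 'n ^ 'n"
  by (simp add: inner_matrix transpose_def) (rule sum.swap)

lemma transpose_add: "transpose (A + B) = transpose A + transpose B" for A B :: "real ^ 'n ^ 'm"
  by (simp add: transpose_def vec_eq_iff)

text \<open>Pairing with a symmetric matrix sees only the symmetric part. Separating functionals,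
  which need not be symmetric, can therefore be symmetrized before their membership in a cone is
  checked.\<close>

lemma inner_symmetrization:
  fixes A B :: "real ^ 'n ^ 'n"
  assumes "transpose B = B"
  shows "((1/2) *\<^sub>R (A + transpose A)) \<bullet> B = A \<bullet> B"
proof -
  have "transpose A \<bullet> B = A \<bullet> B" using inner_transpose[of A B] assms by simp
  then show ?thesis by (simp add: inner_add_left)
qed

lemma transpose_symmetrization:
  "transpose ((1/2) *\<^sub>R (A + transpose A)) = (1/2) *\<^sub>R (A + transpose A)" for A :: "real ^ 'n ^ 'n"
  by (simp add: transpose_def vec_eq_iff add.commute)

lemma compact_matrices_bounded_entries:
  fixes C :: "(real ^ 'n ^ 'm) set"
  assumes "closed C" "\<And>B i j. B \<in> C \<Longrightarrow> \<bar>B $ i $ j\<bar> \<le> R"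
  shows "compact C"
proof -
  have "norm B \<le> real CARD('m) * (real CARD('n) * R)" if "B \<in> C" for B
  proof -
    have "norm B \<le> (\<Sum>i\<in>UNIV. norm (B $ i))"
      by (simp add: norm_vec_def L2_set_le_sum)
    also have "\<dots> \<le> (\<Sum>i\<in>(UNIV::'m set). real CARD('n) * R)"
    proof (rule sum_mono)
      fix i
      have "norm (B $ i) \<le> (\<Sum>j\<in>UNIV. \<bar>B $ i $ j\<bar>)" by (rule norm_le_l1_cart)
      also have "\<dots> \<le> (\<Sum>j\<in>(UNIV::'n set). R)" using assms(2)[OF that] by (intro sum_mono)
      finally show "norm (B $ i) \<le> real CARD('n) * R" by simp
    qed
    finally show ?thesis by simp
  qed
  then have "bounded C" unfolding bounded_iff by blast
  with assms(1) show ?thesis by (simp add: compact_eq_bounded_closed)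
qed

section \<open>Rank-one matrices and the operator norm\<close>

lemma inner_rank_one: "rank_one x \<bullet> B = x \<bullet> (B *v x)"
  by (simp add: inner_matrix rank_one_def inner_vec_def matrix_vector_mult_def sum_distrib_left
      mult_ac)

lemma trace_rank_one: "trace (rank_one x) = (norm x)\<^sup>2"
  unfolding power2_norm_eq_inner by (simp add: trace_def rank_one_def inner_vec_def)

lemma transpose_rank_one: "transpose (rank_one x) = rank_one x"
  by (simp add: transpose_def rank_one_def vec_eq_iff mult.commute)

lemma rank_one_scaleR: "rank_one (c *\<^sub>R x) = c\<^sup>2 *\<^sub>R rank_one x"
  by (simp add: rank_one_def vec_eq_iff power2_eq_square)

lemma continuous_on_rank_one: "continuous_on S rank_one"
  unfolding rank_one_def by (intro continuous_intros)

lemma rank_one_axis_sum: "(\<Sum>i\<in>UNIV. rank_one (axis i 1)) = mat 1"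
proof -
  have "(if j = i then 1 else 0) * (if k = i then 1 else 0)
      = (if i = j then if j = k then 1 else 0 else (0::real))" for i j k :: 'a
    by auto
  then show ?thesis
    by (simp add: vec_eq_iff rank_one_def axis_def mat_def)
qed

lemma op_norm_nonneg: "0 \<le> op_norm M"
  unfolding op_norm_def by (intro onorm_pos_le matrix_vector_mul_bounded_linear)

lemma op_norm_scaled_identity: "op_norm (c *\<^sub>R mat 1 :: real ^ 'n ^ 'n) = \<bar>c\<bar>"
proof -
  have "onorm (\<lambda>x :: real ^ 'n. c *\<^sub>R x) = \<bar>c\<bar> * onorm (\<lambda>x :: real ^ 'n. x)"
    by (rule onorm_scaleR) (rule bounded_linear_ident)
  also have "onorm (\<lambda>x :: real ^ 'n. x) = 1"
    by (rule onorm_id)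
  finally show ?thesis
    by (simp add: op_norm_def scaleR_matrix_vector_assoc[symmetric])
qed

lemma inner_rank_one_le_op_norm: "rank_one x \<bullet> M \<le> op_norm M * trace (rank_one x)"
proof -
  have "rank_one x \<bullet> M \<le> norm x * norm (M *v x)"
    unfolding inner_rank_one by (rule norm_cauchy_schwarz)
  also have "\<dots> \<le> norm x * (op_norm M * norm x)"
    unfolding op_norm_def
    by (intro mult_left_mono onorm matrix_vector_mul_bounded_linear) auto
  finally show ?thesis by (simp add: trace_rank_one power2_eq_square mult_ac)
qed

subsection \<open>The cones of type A\<close>

definition admissible :: "'z set set set \<Rightarrow> (real ^ 'z) set" where
  "admissible d = {x. \<forall>p\<in>d. \<exists>c\<in>p. \<forall>j\<in>c. x $ j = 0}"

text \<open>The parts of different partitions are chosen independently, so this combinatorial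
  condition says exactly that some admissible vector is nonzero at both \<open>i\<close> and
  \<open>j\<close>. On the diagonal it says that the unit vector at \<open>i\<close> is
  admissible.\<close>

definition allowed :: "'z set set set \<Rightarrow> 'z \<Rightarrow> 'z \<Rightarrow> bool" where
  "allowed d i j \<longleftrightarrow> (\<forall>p\<in>d. \<exists>c\<in>p. i \<notin> c \<and> j \<notin> c)"

lemma A_cone_eq: "A_cone d = convex hull (rank_one ` admissible d)"
  unfolding A_cone_def admissible_def by (rule arg_cong[where f = "\<lambda>S. convex hull S"]) auto

lemma admissible_scaleR: "x \<in> admissible d \<Longrightarrow> c *\<^sub>R x \<in> admissible d"
  unfolding admissible_def by fastforce

lemma rank_one_in_A_cone: "x \<in> admissible d \<Longrightarrow> rank_one x \<in> A_cone d"
  unfolding A_cone_eq by (simp add: hull_inc)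

lemma closed_admissible: "closed (admissible d)" for d :: "'z::finite set set set"
proof -
  have "admissible d = (\<Inter>p\<in>d. \<Union>c\<in>p. \<Inter>j\<in>c. {x :: real ^ 'z. x $ j = 0})"
    by (auto simp: admissible_def)
  moreover have "closed {x :: real ^ 'z. x $ j = 0}" for j
    by (intro closed_Collect_eq continuous_intros)
  ultimately show ?thesis
    by (auto intro!: closed_INT closed_UN)
qed

lemma convex_A_cone: "convex (A_cone d)"
  by (simp add: A_cone_eq)

lemma cone_A_cone: "cone (A_cone d)"
  unfolding A_cone_eq
proof (rule cone_convex_hull, unfold cone_def, safe)
  fix x :: "real ^ 'a" and c :: real assume x: "x \<in> admissible d" and c: "0 \<le> c"
  have "c *\<^sub>R rank_one x = rank_one (sqrt c *\<^sub>R x)" using c by (simp add: rank_one_scaleR)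
  then show "c *\<^sub>R rank_one x \<in> rank_one ` admissible d" using admissible_scaleR[OF x] by blast
qed

text \<open>A part that misses \<open>i\<close> and \<open>j\<close> lies in the zero set of this
  vector for every \<open>s\<close>. These vectors later serve as tests on single entries of
  \<open>B\<close>.\<close>

lemma axis_combination_admissible:
  assumes "allowed d i j"
  shows "axis i 1 + s *\<^sub>R axis j 1 \<in> admissible d"
  using assms unfolding admissible_def allowed_def axis_def by fastforce

lemma axis_admissible: "allowed d i i \<Longrightarrow> axis i 1 \<in> admissible d"
  using axis_combination_admissible[of d i i 0] by simp

lemma admissible_imp_allowed:
  "x \<in> admissible d \<Longrightarrow> x $ i \<noteq> 0 \<Longrightarrow> x $ j \<noteq> 0 \<Longrightarrow> allowed d i j"
  unfolding admissible_def allowed_def mem_Collect_eq by metis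

lemma allowed_commute: "allowed d i j \<longleftrightarrow> allowed d j i"
  unfolding allowed_def by blast

section \<open>Compact trace-one bases and closedness of the cones of type A\<close>

definition A_base :: "'z set set set \<Rightarrow> (real ^ 'z ^ 'z) set" where
  "A_base d = convex hull (rank_one ` (admissible d \<inter> sphere 0 1))"

lemma A_base_subset: "A_base d \<subseteq> A_cone d"
  unfolding A_base_def A_cone_eq by (intro hull_mono) auto

text \<open>The admissible unit vectors form a compact set, and in finite dimension the convex hull
  of its continuous image is compact.\<close>

lemma compact_A_base: "compact (A_base d)" for d :: "'z::finite set set set"
  unfolding A_base_def
  by (intro compact_convex_hull compact_continuous_image continuous_on_rank_one
      closed_Int_compact closed_admissible compact_sphere)

lemma trace_A_base:
  assumes "Y \<in> A_base d"
  shows "trace Y = 1"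
proof -
  have "A_base d \<subseteq> {Y. mat 1 \<bullet> Y = 1}"
    unfolding A_base_def
    by (intro hull_minimal convex_hyperplane)
      (auto simp: inner_commute[of "mat 1"] trace_eq_inner[symmetric] trace_rank_one)
  then show ?thesis using assms by (auto simp: trace_eq_inner inner_commute)
qed

text \<open>Normalizing each nonzero generator puts it on a ray through the base. The allowed index
  \<open>i\<close> makes the base nonempty, so the cone over it also contains 0, and the trace
  recovers the scaling factor.\<close>

lemma A_cone_eq_trace_scaleR:
  fixes d :: "'z::finite set set set"
  assumes "allowed d i i" "A \<in> A_cone d"
  obtains Y where "Y \<in> A_base d" "A = trace A *\<^sub>R Y" "0 \<le> trace A"
proof -
  have "axis i 1 \<in> admissible d \<inter> sphere 0 1"
    using axis_admissible[OF assms(1)] by simp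
  then have ne: "A_base d \<noteq> {}" unfolding A_base_def by auto
  have "rank_one x \<in> cone hull (A_base d)" if x: "x \<in> admissible d" for x
  proof (cases "x = 0")
    case True
    then have "rank_one x = 0" by (simp add: rank_one_def vec_eq_iff)
    then show ?thesis using ne cone_hull_contains_0 by auto
  next
    case False
    have "rank_one ((1 / norm x) *\<^sub>R x) \<in> A_base d"
      unfolding A_base_def using False admissible_scaleR[OF x, of "1 / norm x"]
      by (intro hull_inc imageI) simp
    from mem_cone_hull[OF this, of "(norm x)\<^sup>2"] show ?thesis
      using False by (simp add: rank_one_scaleR power_divide)
  qed
  then have "A_cone d \<subseteq> cone hull (A_base d)"
    unfolding A_cone_eq by (intro hull_minimal convex_cone_hull) (auto simp: A_base_def)
  then obtain c Y where cY: "A = c *\<^sub>R Y" "0 \<le> c" "Y \<in> A_base d"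
    using assms(2) unfolding cone_hull_expl by blast
  then have "trace A = c" using trace_A_base[OF cY(3)] by (simp add: trace_eq_inner)
  with cY that show thesis by auto
qed

lemma closed_A_cone:
  fixes d :: "'z::finite set set set"
  assumes "allowed d i i"
  shows "closed (A_cone d)"
proof (rule closed_if_sublevels_closed)
  show "continuous_on UNIV (trace :: real ^ 'z ^ 'z \<Rightarrow> real)"
    unfolding trace_eq_inner by (intro continuous_intros)
  fix R :: real
  let ?K = "(\<lambda>(t, Y). t *\<^sub>R Y) ` ({0..R} \<times> A_base d)"
  have "compact ?K"
    by (intro compact_continuous_image compact_Times compact_A_base compact_Icc)
      (auto simp: case_prod_unfold intro!: continuous_intros)
  moreover have "?K \<subseteq> A_cone d"
    using A_base_subset cone_A_cone[of d] by (auto intro!: mem_cone)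
  moreover have "{A \<in> A_cone d. trace A \<le> R} \<subseteq> ?K"
  proof safe
    fix A assume A: "A \<in> A_cone d" "trace A \<le> R"
    obtain Y where "Y \<in> A_base d" "A = trace A *\<^sub>R Y" "0 \<le> trace A"
      using A_cone_eq_trace_scaleR[OF assms A(1)] .
    with A(2) show "A \<in> ?K" by (intro image_eqI[of _ _ "(trace A, Y)"]) auto
  qed
  ultimately show "\<exists>K. closed K \<and> K \<subseteq> A_cone d \<and> {A \<in> A_cone d. trace A \<le> R} \<subseteq> K"
    using compact_imp_closed by blast
qed

lemma zero_in_A_cone: "allowed d i i \<Longrightarrow> 0 \<in> A_cone d"
  using mem_cone[OF cone_A_cone rank_one_in_A_cone[OF axis_admissible], of d i 0] by simp

text \<open>On rank-one matrices this is Cauchy-Schwarz. The inequality is linear in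
  \<open>A\<close>, hence defines a half-space and passes to the convex hull.\<close>

lemma inner_le_op_norm_trace:
  assumes "A \<in> A_cone d"
  shows "A \<bullet> M \<le> op_norm M * trace A"
proof -
  have "A_cone d \<subseteq> {A. (M - op_norm M *\<^sub>R mat 1) \<bullet> A \<le> 0}"
    unfolding A_cone_eq
  proof (intro hull_minimal convex_halfspace_le, clarify)
    fix x :: "real ^ 'a"
    show "(M - op_norm M *\<^sub>R mat 1) \<bullet> rank_one x \<le> 0"
      using inner_rank_one_le_op_norm[of x M]
      by (simp add: inner_diff_right inner_commute[of _ "rank_one x"] trace_eq_inner)
  qed
  with assms have "(M - op_norm M *\<^sub>R mat 1) \<bullet> A \<le> 0" by blast
  then show ?thesis by (simp add: inner_diff_right trace_eq_inner inner_commute[of _ A])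
qed

subsection \<open>The cones of type B\<close>

lemma symmetric_iff: "transpose B = B \<longleftrightarrow> (\<forall>i j. B $ i $ j = B $ j $ i)"
  for B :: "real ^ 'n ^ 'n"
  by (auto simp: transpose_def vec_eq_iff)

lemma inner_rank_one_supported:
  fixes x :: "real ^ 'z"
  assumes "\<And>i. i \<notin> S \<Longrightarrow> x $ i = 0"
  shows "rank_one x \<bullet> B = (\<Sum>i\<in>S. \<Sum>j\<in>S. x $ i * B $ i $ j * x $ j)"
proof -
  have "(\<Sum>j\<in>UNIV. x $ i * x $ j * B $ i $ j) = (\<Sum>j\<in>S. x $ i * B $ i $ j * x $ j)" for i
    by (rule sum.mono_neutral_cong_right) (use assms in auto)
  then have "rank_one x \<bullet> B = (\<Sum>i\<in>UNIV. \<Sum>j\<in>S. x $ i * B $ i $ j * x $ j)"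
    by (simp add: inner_matrix rank_one_def)
  also have "\<dots> = (\<Sum>i\<in>S. \<Sum>j\<in>S. x $ i * B $ i $ j * x $ j)"
    by (rule sum.mono_neutral_right) (use assms in auto)
  finally show ?thesis .
qed

text \<open>A vector is admissible iff it is supported outside the union of some choice of parts.
  The conditions on all principal submatrices thus combine into nonnegativity on the generators of
  \<open>A_cone d\<close>, which is the form suited to duality.\<close>

lemma B_cone_iff:
  "B \<in> B_cone d \<longleftrightarrow> transpose B = B \<and> (\<forall>x\<in>admissible d. 0 \<le> rank_one x \<bullet> B)"
proof (intro iffI conjI ballI)
  assume B: "B \<in> B_cone d"
  then show "transpose B = B" by (simp add: B_cone_def)
  fix x assume "x \<in> admissible d"
  then obtain c where c: "\<forall>p\<in>d. c p \<in> p \<and> (\<forall>j\<in>c p. x $ j = 0)"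
    unfolding admissible_def by (auto dest!: bchoice simp: Bex_def)
  then have psd: "psd_on (UNIV - (\<Union>p\<in>d. c p)) B" using B by (simp add: B_cone_def)
  have "rank_one x \<bullet> B = (\<Sum>i\<in>UNIV - (\<Union>p\<in>d. c p). \<Sum>j\<in>UNIV - (\<Union>p\<in>d. c p).
      x $ i * B $ i $ j * x $ j)"
    by (rule inner_rank_one_supported) (use c in auto)
  then show "0 \<le> rank_one x \<bullet> B" using psd unfolding psd_on_def by auto
next
  assume B: "transpose B = B \<and> (\<forall>x\<in>admissible d. 0 \<le> rank_one x \<bullet> B)"
  have "psd_on (UNIV - (\<Union>p\<in>d. c p)) B" if c: "\<forall>p\<in>d. c p \<in> p" for c
    unfolding psd_on_def
  proof (intro conjI allI)
    show "\<forall>i\<in>UNIV - (\<Union>p\<in>d. c p). \<forall>j\<in>UNIV - (\<Union>p\<in>d. c p). B $ i $ j = B $ j $ i"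
      using B symmetric_iff by blast
    fix v :: "'a \<Rightarrow> real"
    let ?S = "UNIV - (\<Union>p\<in>d. c p)"
    \<comment> \<open>Extending \<open>v\<close> by zero turns a vector on the principal submatrix
      into an admissible one.\<close>
    define x :: "real ^ 'a" where "x = (\<chi> i. if i \<in> ?S then v i else 0)"
    have "x \<in> admissible d" unfolding admissible_def x_def using c by auto
    then have "0 \<le> rank_one x \<bullet> B" using B by blast
    also have "\<dots> = (\<Sum>i\<in>?S. \<Sum>j\<in>?S. x $ i * B $ i $ j * x $ j)"
      by (rule inner_rank_one_supported) (auto simp: x_def)
    also have "\<dots> = (\<Sum>i\<in>?S. \<Sum>j\<in>?S. v i * B $ i $ j * v j)"
      by (intro sum.cong) (auto simp: x_def)
    finally show "0 \<le> (\<Sum>i\<in>?S. \<Sum>j\<in>?S. v i * B $ i $ j * v j)" .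
  qed
  then show "B \<in> B_cone d" using B by (simp add: B_cone_def)
qed

section \<open>Duality of the two types of cones\<close>

lemma inner_A_cone_B_cone_nonneg:
  assumes "A \<in> A_cone d" "B \<in> B_cone d"
  shows "0 \<le> A \<bullet> B"
proof -
  have "A_cone d \<subseteq> {A. B \<bullet> A \<ge> 0}"
    unfolding A_cone_eq
    by (intro hull_minimal convex_halfspace_ge) (use assms(2) in \<open>auto simp: B_cone_iff inner_commute\<close>)
  then show ?thesis using assms(1) by (auto simp: inner_commute)
qed

text \<open>If \<open>A\<close> were outside the closed cone, a separating functional, once
  symmetrized, would be an element of \<open>B_cone d\<close> pairing negatively with
  \<open>A\<close>.\<close>

lemma in_A_cone_if_dual:
  fixes d :: "'z::finite set set set"
  assumes "allowed d i i" "transpose A = A" "\<And>B. B \<in> B_cone d \<Longrightarrow> 0 \<le> A \<bullet> B"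
  shows "A \<in> A_cone d"
proof (rule ccontr)
  assume "A \<notin> A_cone d"
  then obtain b where b: "b \<bullet> A < 0" "\<And>X. X \<in> A_cone d \<Longrightarrow> 0 \<le> b \<bullet> X"
    using separating_hyperplane_closed_cone[OF convex_A_cone closed_A_cone[OF assms(1)] cone_A_cone
        zero_in_A_cone[OF assms(1)]] by metis
  let ?B = "(1/2) *\<^sub>R (b + transpose b)"
  have "?B \<in> B_cone d"
    unfolding B_cone_iff
  proof (intro conjI ballI)
    show "transpose ?B = ?B" by (rule transpose_symmetrization)
    fix x assume "x \<in> admissible d"
    then have "0 \<le> b \<bullet> rank_one x" by (intro b rank_one_in_A_cone)
    then show "0 \<le> rank_one x \<bullet> ?B"
      using inner_symmetrization[OF transpose_rank_one, of b x] by (simp only: inner_commute)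
  qed
  then have "0 \<le> A \<bullet> ?B" by (rule assms(3))
  also have "\<dots> = b \<bullet> A" using inner_symmetrization[OF assms(2), of b] by (simp only: inner_commute)
  finally show False using b(1) by simp
qed

lemma B_cone_add: "B \<in> B_cone d \<Longrightarrow> C \<in> B_cone d \<Longrightarrow> B + C \<in> B_cone d"
  by (simp add: B_cone_iff transpose_add inner_add_right)

lemma B_cone_scaleR: "B \<in> B_cone d \<Longrightarrow> 0 \<le> c \<Longrightarrow> c *\<^sub>R B \<in> B_cone d"
  by (simp add: B_cone_iff transpose_scalar)

lemma zero_in_B_cone: "0 \<in> B_cone d"
  by (simp add: B_cone_iff symmetric_iff)

lemma closed_B_cone: "closed (B_cone d)"
proof -
  have "B_cone d = (\<Inter>i. \<Inter>j. {B. B $ i $ j = B $ j $ i}) \<inter>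
      (\<Inter>x\<in>admissible d. {B. 0 \<le> rank_one x \<bullet> B})"
    by (auto simp: B_cone_iff symmetric_iff)
  moreover have "closed {B :: real ^ 'a ^ 'a. B $ i $ j = B $ j $ i}" for i j
    by (intro closed_Collect_eq continuous_intros)
  moreover have "closed {B. 0 \<le> rank_one x \<bullet> B}" for x :: "real ^ 'a"
    by (intro closed_Collect_le continuous_intros)
  ultimately show ?thesis by (auto intro!: closed_Int closed_INT)
qed

lemma inner_rank_one_axis_combination:
  "rank_one (axis i 1 + s *\<^sub>R axis j 1) \<bullet> B
     = B $ i $ i + s * B $ i $ j + s * B $ j $ i + s\<^sup>2 * B $ j $ j"
  unfolding inner_rank_one
  by (simp add: matrix_vector_right_distrib matrix_vector_mult_scaleR matrix_vector_mult_basis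
      inner_add_left inner_add_right inner_axis_axis inner_axis' column_def power2_eq_square
      algebra_simps)

lemma B_cone_diagonal_nonneg:
  assumes "allowed d i i" "B \<in> B_cone d"
  shows "0 \<le> B $ i $ i"
proof -
  have "0 \<le> rank_one (axis i 1 + 0 *\<^sub>R axis i 1) \<bullet> B"
    using assms axis_combination_admissible unfolding B_cone_iff by blast
  then show ?thesis unfolding inner_rank_one_axis_combination by simp
qed

lemma B_cone_trace_nonneg: "(\<And>i. allowed d i i) \<Longrightarrow> B \<in> B_cone d \<Longrightarrow> 0 \<le> trace B"
  unfolding trace_def by (intro sum_nonneg B_cone_diagonal_nonneg)

text \<open>Testing with \<open>s = 1\<close> and \<open>s = -1\<close> bounds twice the absolute
  value of the entry by the sum of the diagonal entries at \<open>i\<close> and \<open>j\<close>.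
  Each of these is at most the trace, as the diagonal is nonnegative.\<close>

lemma B_cone_allowed_entry_bound:
  fixes d :: "'z::finite set set set"
  assumes "\<And>i. allowed d i i" "B \<in> B_cone d" "allowed d i j"
  shows "\<bar>B $ i $ j\<bar> \<le> trace B"
proof -
  have nonneg: "0 \<le> rank_one (axis i 1 + s *\<^sub>R axis j 1) \<bullet> B" for s
    using assms(2) axis_combination_admissible[OF assms(3)] unfolding B_cone_iff by blast
  have "B $ k $ k \<le> trace B" for k
    unfolding trace_def
    by (rule member_le_sum) (use assms B_cone_diagonal_nonneg in auto)
  from this[of i] this[of j] show ?thesis
    using nonneg[of 1] nonneg[of "-1"] assms(2)
    unfolding inner_rank_one_axis_combination B_cone_iff symmetric_iff
    by (auto simp: abs_le_iff)
qed

subsection \<open>Closedness of the sum of the cones of type B\<close>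

definition restrict_allowed :: "'z set set set \<Rightarrow> real ^ 'z ^ 'z \<Rightarrow> real ^ 'z ^ 'z" where
  "restrict_allowed d B = (\<chi> i j. if allowed d i j then B $ i $ j else 0)"

text \<open>For admissible \<open>x\<close> the product \<open>x $ i * x $ j\<close> vanishes at
  every pair that is not allowed, so erasing those entries does not change the quadratic form on
  admissible vectors.\<close>

lemma restrict_allowed_in_B_cone:
  assumes "B \<in> B_cone d"
  shows "restrict_allowed d B \<in> B_cone d"
proof -
  have "rank_one x \<bullet> restrict_allowed d B = rank_one x \<bullet> B" if "x \<in> admissible d" for x
    unfolding inner_matrix
    by (intro sum.cong refl)
      (use admissible_imp_allowed[OF that] in \<open>auto simp: rank_one_def restrict_allowed_def\<close>)
  then show ?thesis
    using assms by (auto simp: B_cone_iff symmetric_iff restrict_allowed_def allowed_commute)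
qed

definition B_sum :: "'z set set set set \<Rightarrow> (real ^ 'z ^ 'z) set" where
  "B_sum D = {sum B D | B. \<forall>d\<in>D. B d \<in> B_cone d}"

lemma B_sum_add:
  assumes "X \<in> B_sum D" "Y \<in> B_sum D"
  shows "X + Y \<in> B_sum D"
proof -
  obtain B C where "X = sum B D" "\<forall>d\<in>D. B d \<in> B_cone d" "Y = sum C D" "\<forall>d\<in>D. C d \<in> B_cone d"
    using assms by (auto simp: B_sum_def)
  then have "X + Y = sum (\<lambda>d. B d + C d) D" "\<forall>d\<in>D. B d + C d \<in> B_cone d"
    by (auto simp: sum.distrib B_cone_add)
  then show ?thesis unfolding B_sum_def by blast
qed

lemma B_sum_scaleR:
  assumes "X \<in> B_sum D" "0 \<le> c"
  shows "c *\<^sub>R X \<in> B_sum D"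
proof -
  obtain B where "X = sum B D" "\<forall>d\<in>D. B d \<in> B_cone d"
    using assms by (auto simp: B_sum_def)
  then have "c *\<^sub>R X = sum (\<lambda>d. c *\<^sub>R B d) D" "\<forall>d\<in>D. c *\<^sub>R B d \<in> B_cone d"
    using assms(2) by (auto simp: scaleR_right.sum B_cone_scaleR)
  then show ?thesis unfolding B_sum_def by blast
qed

lemma B_cone_subset_B_sum:
  fixes D :: "'z::finite set set set set"
  assumes "d \<in> D" "B \<in> B_cone d"
  shows "B \<in> B_sum D"
proof -
  have "B = (\<Sum>e\<in>D. if e = d then B else 0)" using assms(1) by simp
  moreover have "\<forall>e\<in>D. (if e = d then B else 0) \<in> B_cone e"
    using assms(2) zero_in_B_cone by auto
  ultimately show ?thesis
    unfolding B_sum_def by (intro CollectI exI[of _ "\<lambda>e. if e = d then B else 0"]) auto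
qed

text \<open>The linear subspace inside \<open>B_sum D\<close>: an entry of the sum is unrestricted
  as soon as a single \<open>d\<close> in \<open>D\<close> does not allow it.\<close>

definition free_part :: "'z set set set set \<Rightarrow> (real ^ 'z ^ 'z) set" where
  "free_part D = {Y. transpose Y = Y \<and> (\<forall>i j. (\<forall>d\<in>D. allowed d i j) \<longrightarrow> Y $ i $ j = 0)}"

lemma closed_free_part: "closed (free_part D)"
proof -
  have "free_part D = (\<Inter>i. \<Inter>j. {Y. Y $ i $ j = Y $ j $ i}) \<inter>
      (\<Inter>(i, j)\<in>{(i, j). \<forall>d\<in>D. allowed d i j}. {Y. Y $ i $ j = 0})"
    by (auto simp: free_part_def symmetric_iff)
  moreover have "closed {Y :: real ^ 'a ^ 'a. Y $ i $ j = Y $ j $ i}" for i j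
    by (intro closed_Collect_eq continuous_intros)
  moreover have "closed {Y :: real ^ 'a ^ 'a. Y $ i $ j = 0}" for i j
    by (intro closed_Collect_eq continuous_intros)
  ultimately show ?thesis by (auto intro!: closed_Int closed_INT)
qed

lemma free_part_subset_B_sum:
  fixes D :: "'z::finite set set set set"
  shows "free_part D \<subseteq> B_sum D"
proof
  fix Y assume Y: "Y \<in> free_part D"
  \<comment> \<open>Each entry not allowed for all of \<open>D\<close> is assigned to one \<open>d\<close> for which it is not allowed.\<close>
  define sel where "sel i j = (SOME d. d \<in> D \<and> \<not> allowed d i j)" for i j
  define B where "B d = (\<chi> i j. if sel i j = d then Y $ i $ j else 0)" for d
  have sel: "sel i j \<in> D \<and> \<not> allowed (sel i j) i j" if "Y $ i $ j \<noteq> 0" for i j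
    unfolding sel_def by (rule someI_ex) (use that Y in \<open>auto simp: free_part_def\<close>)
  have "B d \<in> B_cone d" for d
    unfolding B_cone_iff
  proof (intro conjI ballI)
    \<comment> \<open>The predicate under \<open>SOME\<close> is symmetric in \<open>i\<close> and
      \<open>j\<close>, so both positions get the same choice and each \<open>B d\<close> stays
      symmetric.\<close>
    have "sel i j = sel j i" for i j unfolding sel_def by (simp add: allowed_commute)
    then show "transpose (B d) = B d" using Y by (simp add: symmetric_iff B_def free_part_def)
    fix x assume x: "x \<in> admissible d"
    have "x $ i * x $ j * B d $ i $ j = 0" for i j
      using sel[of i j] admissible_imp_allowed[OF x, of i j] by (auto simp: B_def)
    then have "0 \<le> x $ i * x $ j * B d $ i $ j" for i j
      by (metis order_refl)
    then show "0 \<le> rank_one x \<bullet> B d"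
      unfolding inner_matrix rank_one_def by (intro sum_nonneg) simp
  qed
  moreover have "sum B D = Y"
  proof -
    have "(\<Sum>d\<in>D. if sel i j = d then Y $ i $ j else 0) = Y $ i $ j" for i j
      using sel[of i j] by (auto simp: sum.delta)
    then show ?thesis by (simp add: vec_eq_iff B_def)
  qed
  ultimately show "Y \<in> B_sum D" unfolding B_sum_def by blast
qed

lemma closed_B_sum:
  fixes D :: "'z::finite set set set set"
  assumes allowed: "\<And>d i. d \<in> D \<Longrightarrow> allowed d i i"
  shows "closed (B_sum D)"
proof (rule closed_if_sublevels_closed)
  show "continuous_on UNIV (trace :: real ^ 'z ^ 'z \<Rightarrow> real)"
    unfolding trace_eq_inner by (intro continuous_intros)
  fix R :: real
  \<comment> \<open>Erasing the disallowed entries and capping the trace leaves a bounded part of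
    \<open>B_cone d\<close>. The erased entries are restored by adding \<open>free_part D\<close>,
    so \<open>?K\<close> is a compact set plus a closed subspace.\<close>
  define X where "X d = {B \<in> B_cone d. trace B \<le> R \<and> (\<forall>i j. \<not> allowed d i j \<longrightarrow> B $ i $ j = 0)}"
    for d :: "'z set set set"
  let ?C = "{sum B D | B. \<forall>d\<in>D. B d \<in> X d}"
  let ?K = "\<Union>x\<in>?C. \<Union>y\<in>free_part D. {x + y}"
  have "compact (X d)" if d: "d \<in> D" for d
  proof (rule compact_matrices_bounded_entries)
    have "X d = B_cone d \<inter> {B. trace B \<le> R} \<inter>
        (\<Inter>(i, j)\<in>{(i, j). \<not> allowed d i j}. {B. B $ i $ j = 0})"
      by (auto simp: X_def)
    moreover have "closed {B :: real ^ 'z ^ 'z. trace B \<le> R}"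
      unfolding trace_eq_inner by (intro closed_Collect_le continuous_intros)
    moreover have "closed {B :: real ^ 'z ^ 'z. B $ i $ j = 0}" for i j
      by (intro closed_Collect_eq continuous_intros)
    ultimately show "closed (X d)" by (auto intro!: closed_Int closed_INT closed_B_cone)
    fix B i j assume "B \<in> X d"
    then have B: "B \<in> B_cone d" "trace B \<le> R" "\<not> allowed d i j \<longrightarrow> B $ i $ j = 0"
      by (auto simp: X_def)
    then show "\<bar>B $ i $ j\<bar> \<le> R"
      using B_cone_allowed_entry_bound[OF allowed[OF d] B(1), of i j]
        B_cone_trace_nonneg[OF allowed[OF d] B(1)] by (cases "allowed d i j") auto
  qed
  then have "closed ?K"
    by (intro compact_closed_sums compact_setsum closed_free_part) auto
  moreover have "?K \<subseteq> B_sum D"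
  proof -
    have "?C \<subseteq> B_sum D" unfolding B_sum_def X_def by blast
    then show ?thesis using free_part_subset_B_sum by (fast intro: B_sum_add)
  qed
  moreover have "{M \<in> B_sum D. trace M \<le> R} \<subseteq> ?K"
  proof safe
    fix M assume "M \<in> B_sum D" and tr: "trace M \<le> R"
    then obtain B where M: "M = sum B D" and B: "\<And>d. d \<in> D \<Longrightarrow> B d \<in> B_cone d"
      by (auto simp: B_sum_def)
    define C where "C d = restrict_allowed d (B d)" for d
    have "C d \<in> X d" if d: "d \<in> D" for d
    proof -
      have "trace (C d) = trace (B d)"
        using allowed[OF d] by (simp add: C_def trace_def restrict_allowed_def)
      \<comment> \<open>No cancellation is possible between the traces, since all are nonnegative.
        The bound on the trace of the sum thus bounds every summand.\<close>
      also have "\<dots> \<le> (\<Sum>d\<in>D. trace (B d))"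
        by (rule member_le_sum[OF d]) (auto intro!: B_cone_trace_nonneg B allowed)
      also have "\<dots> \<le> R" using tr by (simp add: M trace_eq_inner inner_sum_left)
      finally show ?thesis
        using restrict_allowed_in_B_cone[OF B[OF d]]
        by (simp add: X_def C_def) (simp add: restrict_allowed_def)
    qed
    then have "sum C D \<in> ?C" by blast
    \<comment> \<open>Each difference consists only of entries that its own \<open>d\<close> does
      not allow, so the sum vanishes at pairs allowed for all of \<open>D\<close>.\<close>
    moreover have "(\<Sum>d\<in>D. B d - C d) \<in> free_part D"
    proof -
      have "(B d - C d) $ i $ j = (B d - C d) $ j $ i" if "d \<in> D" for d i j
        using B[OF that] allowed_commute[of d i j]
        by (simp add: C_def restrict_allowed_def B_cone_iff symmetric_iff)
      moreover have "(B d - C d) $ i $ j = 0" if "allowed d i j" for d i j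
        using that by (simp add: C_def restrict_allowed_def)
      ultimately show ?thesis
        unfolding free_part_def symmetric_iff sum_component by auto
    qed
    moreover have "M = sum C D + (\<Sum>d\<in>D. B d - C d)"
      by (simp add: M sum_subtractf)
    ultimately show "M \<in> ?K" by blast
  qed
  ultimately show "\<exists>K. closed K \<and> K \<subseteq> B_sum D \<and> {M \<in> B_sum D. trace M \<le> R} \<subseteq> K"
    by blast
qed

text \<open>Since \<open>B_sum D\<close> contains every single \<open>B_cone d\<close>, a functional
  nonnegative on it is, after symmetrization, in every \<open>A_cone d\<close> by duality. It then
  lies in the intersection, where \<open>M\<close> is nonnegative, so it cannot separate
  \<open>M\<close>.\<close>

lemma B_sum_if_dual:
  fixes D :: "'z::finite set set set set"
  assumes allowed: "\<And>d i. d \<in> D \<Longrightarrow> allowed d i i"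
    and "transpose M = M"
    and M: "\<And>A. A \<in> (\<Inter>d\<in>D. A_cone d) \<Longrightarrow> 0 \<le> A \<bullet> M"
  shows "M \<in> B_sum D"
proof (rule ccontr)
  assume "M \<notin> B_sum D"
  moreover have "convex (B_sum D) \<and> cone (B_sum D)"
    unfolding convex_cone by (simp add: B_sum_add B_sum_scaleR)
  moreover have "0 \<in> B_sum D"
    unfolding B_sum_def by (intro CollectI exI[of _ "\<lambda>_. 0"]) (simp add: zero_in_B_cone)
  ultimately obtain a where a: "a \<bullet> M < 0" "\<And>X. X \<in> B_sum D \<Longrightarrow> 0 \<le> a \<bullet> X"
    using separating_hyperplane_closed_cone[OF _ closed_B_sum[OF allowed]] by metis
  let ?A = "(1/2) *\<^sub>R (a + transpose a)"
  have "?A \<in> A_cone d" if d: "d \<in> D" for d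
  proof (rule in_A_cone_if_dual[OF allowed[OF d] transpose_symmetrization])
    fix B assume B: "B \<in> B_cone d"
    then have "transpose B = B" by (simp add: B_cone_iff)
    then show "0 \<le> ?A \<bullet> B"
      using a(2)[OF B_cone_subset_B_sum[OF d B]] inner_symmetrization[of B a] by simp
  qed
  then have "0 \<le> ?A \<bullet> M" by (intro M) blast
  then show False using a(1) inner_symmetrization[OF assms(2), of a] by simp
qed

subsection \<open>The duality theorem\<close>

text \<open>Adding the \<open>B d\<close> can only increase the pairing with \<open>A\<close>.
  Nonemptiness of \<open>D\<close> puts \<open>A\<close> in some \<open>A_cone d\<close>, where the
  operator norm bound applies.\<close>

lemma weak_duality:
  assumes "A \<in> (\<Inter>d\<in>D. A_cone d)" "D \<noteq> {}" "\<forall>d\<in>D. B d \<in> B_cone d"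
  shows "A \<bullet> J \<le> op_norm ((\<Sum>d\<in>D. B d) + J) * trace A"
proof -
  have "0 \<le> (\<Sum>d\<in>D. A \<bullet> B d)"
    by (intro sum_nonneg inner_A_cone_B_cone_nonneg) (use assms in auto)
  then have "A \<bullet> J \<le> A \<bullet> ((\<Sum>d\<in>D. B d) + J)" by (simp add: inner_add_right inner_sum_right)
  also have "\<dots> \<le> op_norm ((\<Sum>d\<in>D. B d) + J) * trace A"
  proof -
    obtain d where "d \<in> D" using assms(2) by blast
    then have "A \<in> A_cone d" using assms(1) by blast
    then show ?thesis by (rule inner_le_op_norm_trace)
  qed
  finally show ?thesis .
qed

text \<open>If all parts contained \<open>i\<close>, disjointness would leave a single part, and
  covering would make it \<open>UNIV\<close>.\<close>

lemma partition_part_avoiding: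
  assumes "partition_on UNIV p" "p \<noteq> {UNIV}"
  shows "\<exists>c\<in>p. i \<notin> c"
proof (rule ccontr)
  assume "\<not> ?thesis"
  then have all: "\<And>c. c \<in> p \<Longrightarrow> i \<in> c" by blast
  obtain c where c: "c \<in> p" "i \<in> c"
    using assms(1) unfolding partition_on_def by blast
  have "e = c" if "e \<in> p" for e
    using assms(1) all[OF that] all[OF c(1)] that c(1) unfolding partition_on_def disjoint_def by blast
  then have "p = {c}" using c(1) by blast
  with assms show False unfolding partition_on_def by auto
qed

theorem theorem1:
  fixes P :: "'z::finite set set set" and D :: "'z set set set set"
  assumes "\<forall>p\<in>P. partition_on (UNIV :: 'z set) p"
    and "\<forall>d\<in>D. d \<subseteq> P"
    and "D \<noteq> {}"
  shows "\<exists>B :: 'z set set set \<Rightarrow> real ^ 'z ^ 'z.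
    is_arg_min (\<lambda>B. op_norm ((\<Sum>d\<in>D. B d) + all_ones)) (\<lambda>B. \<forall>d\<in>D. B d \<in> B_cone d) B \<and>
    (\<exists>c :: real. (\<Sum>d\<in>D. B d) + all_ones = c *\<^sub>R mat 1) \<and>
    (if \<exists>A \<in> (\<Inter>d\<in>D. A_cone d). trace A \<noteq> 0
     then \<exists>A. is_arg_max (\<lambda>A. trace (A ** all_ones) / trace A)
                (\<lambda>A. A \<in> (\<Inter>d\<in>D. A_cone d) \<and> trace A \<noteq> 0) A \<and>
              trace (A ** all_ones) / trace A = op_norm ((\<Sum>d\<in>D. B d) + all_ones)
     else op_norm ((\<Sum>d\<in>D. B d) + all_ones) = 0)"
proof (cases "\<exists>d\<in>D. {UNIV} \<in> d")
  case True
  then obtain d where d: "d \<in> D" "{UNIV} \<in> d" by blast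
  then have adm: "x = 0" if "x \<in> admissible d" for x :: "real ^ 'z"
    using that by (auto simp: admissible_def vec_eq_iff)
  have trivial: "rank_one x = 0" if "x \<in> admissible d" for x :: "real ^ 'z"
    using adm[OF that] by (simp add: rank_one_def vec_eq_iff)
  have "A = 0" if "A \<in> A_cone d" for A
  proof -
    have "A_cone d \<subseteq> {0}" unfolding A_cone_eq by (rule hull_minimal) (auto simp: trivial)
    then show ?thesis using that by blast
  qed
  \<comment> \<open>The quotient has no admissible argument here, so the \<open>else\<close> branch
    of the statement is the one to prove.\<close>
  then have no_A: "\<not> (\<exists>A\<in>(\<Inter>d\<in>D. A_cone d). trace A \<noteq> 0)"
    using d(1) by (force simp: trace_eq_inner)
  \<comment> \<open>Only the zero vector is admissible for \<open>d\<close>, so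
    \<open>B_cone d\<close> contains every symmetric matrix, and this one cancels
    \<open>all_ones\<close>.\<close>
  have "- all_ones \<in> B_cone d"
    by (simp add: B_cone_iff symmetric_iff all_ones_def trivial)
  then have "- all_ones \<in> B_sum D" by (rule B_cone_subset_B_sum[OF d(1)])
  then obtain B where B: "\<forall>d\<in>D. B d \<in> B_cone d" and "- all_ones = (\<Sum>d\<in>D. B d)"
    unfolding B_sum_def by blast
  then have sum: "(\<Sum>d\<in>D. B d) + all_ones = 0 *\<^sub>R mat 1"
    by (metis add.left_inverse scaleR_zero_left)
  have "op_norm ((\<Sum>d\<in>D. B d) + all_ones) = 0"
    unfolding sum op_norm_scaled_identity by simp
  with B sum no_A show ?thesis
    by (intro exI[of _ B]) (auto simp: is_arg_min_def not_less op_norm_nonneg)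
next
  case False
  have allowed: "allowed d i i" if "d \<in> D" for d i
  proof -
    have "\<exists>c\<in>p. i \<notin> c" if "p \<in> d" for p
      by (rule partition_part_avoiding) (use that \<open>d \<in> D\<close> False assms(1,2) in auto)
    then show ?thesis by (simp add: allowed_def)
  qed
  \<comment> \<open>The quotient is invariant under positive scaling, so it suffices to maximize on
    trace one. There the intersection sits inside the compact base of a single cone.\<close>
  define F where "F = {A \<in> (\<Inter>d\<in>D. A_cone d). trace A = 1}"
  obtain d\<^sub>0 where d\<^sub>0: "d\<^sub>0 \<in> D" using assms(3) by blast
  have in_base: "A \<in> A_base d\<^sub>0" if "A \<in> F" for A
    using that d\<^sub>0 A_cone_eq_trace_scaleR[OF allowed[OF d\<^sub>0], of A] by (auto simp: F_def)
  have "F = A_base d\<^sub>0 \<inter> ((\<Inter>d\<in>D. A_cone d) \<inter> {A. trace A = 1})"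
    using in_base by (auto simp: F_def)
  moreover have "closed {A :: real ^ 'z ^ 'z. trace A = 1}"
    unfolding trace_eq_inner by (intro closed_Collect_eq continuous_intros)
  ultimately have "compact F"
    using closed_A_cone[OF allowed]
    by (auto intro!: compact_Int_closed closed_Int closed_INT compact_A_base)
  \<comment> \<open>This point makes \<open>F\<close> nonempty, so the maximum is attained; its
    nonnegative pairing with \<open>all_ones\<close> then yields \<open>0 \<le> c\<close>.\<close>
  moreover have identity: "(1 / real CARD('z)) *\<^sub>R mat 1 \<in> F"
  proof -
    have "mat 1 \<in> A_cone d" if d: "d \<in> D" for d
      unfolding rank_one_axis_sum[symmetric]
      by (intro cone_sum convex_A_cone cone_A_cone zero_in_A_cone[OF allowed[OF d]]
          rank_one_in_A_cone axis_admissible allowed[OF d])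
    then have "(1 / real CARD('z)) *\<^sub>R mat 1 \<in> A_cone d" if "d \<in> D" for d
      using that by (intro mem_cone[OF cone_A_cone]) auto
    moreover have "trace ((1 / real CARD('z)) *\<^sub>R mat 1 :: real ^ 'z ^ 'z) = 1"
      using trace_I[where 'n = 'z and 'a = real] by (simp add: trace_eq_inner)
    ultimately show ?thesis by (simp add: F_def)
  qed
  moreover have "continuous_on F (\<lambda>A. A \<bullet> all_ones)" by (intro continuous_intros)
  ultimately obtain A\<^sub>0 where A\<^sub>0: "A\<^sub>0 \<in> F" and max: "\<And>A. A \<in> F \<Longrightarrow> A \<bullet> all_ones \<le> A\<^sub>0 \<bullet> all_ones"
    using continuous_attains_sup[of F "\<lambda>A. A \<bullet> all_ones"] by blast
  define c where "c = A\<^sub>0 \<bullet> all_ones"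
  have "0 \<le> ((1 / real CARD('z)) *\<^sub>R mat 1 :: real ^ 'z ^ 'z) \<bullet> all_ones"
    unfolding inner_matrix all_ones_def by (intro sum_nonneg) (simp add: mat_def)
  then have c: "0 \<le> c" using max[OF identity] by (simp add: c_def)
  \<comment> \<open>The maximum over \<open>F\<close> extends to the whole intersection by
    homogeneity; trace zero forces \<open>A = 0\<close>.\<close>
  have bound: "A \<bullet> all_ones \<le> c * trace A \<and> 0 \<le> trace A" if A: "A \<in> (\<Inter>d\<in>D. A_cone d)" for A
  proof -
    obtain Y where Y: "A = trace A *\<^sub>R Y" "0 \<le> trace A"
      using A_cone_eq_trace_scaleR[OF allowed[OF d\<^sub>0], of A] A d\<^sub>0 by blast
    show ?thesis
    proof (cases "trace A = 0")
      case True
      then show ?thesis using Y by simp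
    next
      case False
      have "(1 / trace A) *\<^sub>R A \<in> F"
        using A Y(2) False by (auto simp: F_def trace_eq_inner intro!: mem_cone[OF cone_A_cone])
      from max[OF this] show ?thesis using Y(2) False by (simp add: c_def field_simps)
    qed
  qed
  have "c *\<^sub>R mat 1 - all_ones \<in> B_sum D"
  proof (rule B_sum_if_dual[OF allowed])
    show "transpose (c *\<^sub>R mat 1 - all_ones :: real ^ 'z ^ 'z) = c *\<^sub>R mat 1 - all_ones"
      by (simp add: symmetric_iff all_ones_def mat_def)
    fix A assume "A \<in> (\<Inter>d\<in>D. A_cone d)"
    then show "0 \<le> A \<bullet> (c *\<^sub>R mat 1 - all_ones)"
      using bound[of A] by (simp add: inner_diff_right trace_eq_inner)
  qed
  then obtain B where B: "\<forall>d\<in>D. B d \<in> B_cone d" and "c *\<^sub>R mat 1 - all_ones = (\<Sum>d\<in>D. B d)"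
    by (auto simp: B_sum_def)
  then have sum: "(\<Sum>d\<in>D. B d) + all_ones = c *\<^sub>R mat 1" by (simp add: algebra_simps)
  have A\<^sub>0': "A\<^sub>0 \<in> (\<Inter>d\<in>D. A_cone d)" "trace A\<^sub>0 = 1" using A\<^sub>0 by (auto simp: F_def)
  \<comment> \<open>The norm of the multiple of the identity is the absolute value of
    \<open>c\<close>, hence \<open>c\<close> by its sign.\<close>
  have norm: "op_norm ((\<Sum>d\<in>D. B d) + all_ones) = c"
    unfolding sum op_norm_scaled_identity using c by simp
  \<comment> \<open>Weak duality at the maximizer \<open>A\<^sub>0\<close>, which has trace one,
    makes \<open>c\<close> a lower bound for every feasible choice.\<close>
  have "c \<le> op_norm ((\<Sum>d\<in>D. B' d) + all_ones)" if "\<forall>d\<in>D. B' d \<in> B_cone d" for B'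
    using weak_duality[OF A\<^sub>0'(1) assms(3) that, of all_ones] A\<^sub>0'(2) by (simp add: c_def)
  then have "is_arg_min (\<lambda>B. op_norm ((\<Sum>d\<in>D. B d) + all_ones)) (\<lambda>B. \<forall>d\<in>D. B d \<in> B_cone d) B"
    using B by (auto simp: is_arg_min_def norm not_less)
  moreover have "is_arg_max (\<lambda>A. trace (A ** all_ones) / trace A)
      (\<lambda>A. A \<in> (\<Inter>d\<in>D. A_cone d) \<and> trace A \<noteq> 0) A\<^sub>0"
  proof -
    have "(A \<bullet> all_ones) / trace A \<le> c" if "A \<in> (\<Inter>d\<in>D. A_cone d)" "trace A \<noteq> 0" for A
      using bound[OF that(1)] that(2) by (simp add: divide_le_eq)
    then show ?thesis
      using A\<^sub>0' by (auto simp: is_arg_max_def trace_mult_all_ones c_def[symmetric] not_less)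
  qed
  moreover have "trace (A\<^sub>0 ** all_ones) / trace A\<^sub>0 = op_norm ((\<Sum>d\<in>D. B d) + all_ones)"
    unfolding norm trace_mult_all_ones using A\<^sub>0'(2) by (simp add: c_def)
  moreover have "\<exists>A\<in>(\<Inter>d\<in>D. A_cone d). trace A \<noteq> 0" using A\<^sub>0' by force
  ultimately show ?thesis using sum by (intro exI[of _ B]) auto
qed

end
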